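(* Let $m\geq 2$ be an integer and let $X=\{X(j)\}_{j\geq 1}$ be a modulo-$m$ Toeplitz fixed point over a finite alphabet $\mathcal A$ which is not a constant word. Let $q\geq 2$ be an integer such that $m\nmid q$ and $q\mid m^s$ for some integer $s\geq 1$. Let $X(q\mathbb N)$ denote the sequence $\{X(qj)\}_{j\geq 1}$. Then the following hold: (i) If $q\nmid m^2$, then $X(q\mathbb N)$ is not a modulo-$m$ Toeplitz fixed point. (ii) If $q\mid m$, then $X(q\mathbb N)$ is a modulo-$m$ Toeplitz fixed point if and only if the finite word $X(1)\dots X(m)$ is almost $q$-periodic. (iii) If $q\mid m^2$, then $X(q\mathbb N)$ is a modulo-$m$ Toeplitz fixed point if and only if the finite word $X(1)\dots X(m^2)$ is almost $q$-periodic.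
   Context: Let $\mathcal A$ be a finite set (alphabet). All words and sequences are indexed starting from $1$, and $\mathbb N=\{1,2,3,\dots\}$. Modulo-$m$ Toeplitz fixed point: let $m\geq 2$ and let $W=w_1\dots w_{m-1}$ be a word of length $m-1$ over $\mathcal A$. The Toeplitz substitution determined by $W$ is the morphism $\sigma$ on finite and infinite words over $\mathcal A$ with $\sigma(a)=Wa$ (concatenation) for every letter $a\in\mathcal A$. The infinite word $X=\lim_{k\to\infty}\sigma^k(w_1)$ (each $\sigma^k(w_1)$ is a prefix of $\sigma^{k+1}(w_1)$) is called the fixed point of $\sigma$. An infinite word over $\mathcal A$ is a modulo-$m$ Toeplitz fixed point if it arises in this way from some word $W$ of length $m-1$ over $\mathcal A$. Almost $q$-periodic: a finite word $w_1\dots w_n$ with $2\leq q<n$ is almost $q$-periodic if $w_j=w_{j+q}$ for all $1\leq j\leq n-q$ with $q\nmid j$. *)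

theory Defs
  imports Complex_Main
begin

text \<open>Finite words are lists. Infinite words are functions \<open>nat \<Rightarrow> 'a\<close> indexed from 1: the value at 0
  is not part of the word, and every notion below ignores it. The \<open>j\<close>-th letter (\<open>j \<ge> 1\<close>) of a finite
  word \<open>w\<close> is \<open>w ! (j - 1)\<close>.\<close>

definition letter :: "'a list \<Rightarrow> nat \<Rightarrow> 'a" where
  "letter w j = w ! (j - 1)"

definition toeplitz_subst :: "'a list \<Rightarrow> 'a list \<Rightarrow> 'a list" where
  "toeplitz_subst W u = concat (map (\<lambda>a. W @ [a]) u)"

text \<open>Letterwise convergence of a sequence of finite words to an infinite word.\<close>

definition word_limit :: "(nat \<Rightarrow> 'a list) \<Rightarrow> (nat \<Rightarrow> 'a) \<Rightarrow> bool" where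
  "word_limit w X \<longleftrightarrow>
     (\<forall>j\<ge>1. \<forall>\<^sub>F k in sequentially. j \<le> length (w k) \<and> letter (w k) j = X j)"

definition toeplitz_fixed_point :: "'a set \<Rightarrow> nat \<Rightarrow> (nat \<Rightarrow> 'a) \<Rightarrow> bool" where
  "toeplitz_fixed_point A m X \<longleftrightarrow>
     m \<ge> 2 \<and>
     (\<exists>W. set W \<subseteq> A \<and> length W = m - 1 \<and>
          word_limit (\<lambda>k. (toeplitz_subst W ^^ k) [letter W 1]) X)"

definition constant_word :: "(nat \<Rightarrow> 'a) \<Rightarrow> bool" where
  "constant_word X \<longleftrightarrow> (\<exists>a. \<forall>j\<ge>1. X j = a)"

definition almost_periodic :: "nat \<Rightarrow> 'a list \<Rightarrow> bool" where
  "almost_periodic q w \<longleftrightarrow>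
     2 \<le> q \<and> q < length w \<and>
     (\<forall>j. 1 \<le> j \<and> j \<le> length w - q \<and> \<not> q dvd j \<longrightarrow> letter w j = letter w (j + q))"

definition prefix_word :: "(nat \<Rightarrow> 'a) \<Rightarrow> nat \<Rightarrow> 'a list" where
  "prefix_word X n = map X [1..<n + 1]"

definition subword_multiples :: "(nat \<Rightarrow> 'a) \<Rightarrow> nat \<Rightarrow> (nat \<Rightarrow> 'a)" where
  "subword_multiples X q = (\<lambda>j. X (q * j))"

end

theory Submission
  imports Defs
begin

text \<open>A word \<open>X\<close> is a modulo-\<open>m\<close> Toeplitz fixed point iff \<open>X (m j) = X j\<close> for all \<open>j\<close> and
  \<open>X (j + m) = X j\<close> whenever \<open>m\<close> does not divide \<open>j\<close>. The first condition passes to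
  \<open>Y j = X (q j)\<close>. Write \<open>q = g e g p\<close> and \<open>m = g e n\<close> with \<open>g p\<close> prime to \<open>n\<close> and \<open>p\<close> prime to
  \<open>e\<close>; then \<open>q\<close> divides \<open>m\<^sup>2\<close> iff \<open>p = 1\<close>. If \<open>Y\<close> is Toeplitz, evaluating its second condition at
  \<open>j = e n\<^sup>2 k\<close> gives \<open>X (p k) = X q\<close> for all \<open>k\<close> not divisible by \<open>g\<close>. For \<open>p > 1\<close> this forces \<open>X\<close> to
  be constant, and for \<open>p = 1\<close> it yields \<open>X (j + q) = X j\<close> for all \<open>j\<close> not divisible by \<open>q\<close>. The latter
  condition conversely makes \<open>Y\<close> Toeplitz, and it can be read off any prefix of length \<open>m ^ t > q\<close> with
  \<open>q\<close> dividing \<open>m ^ t\<close>, because \<open>X\<close> has period \<open>m ^ t\<close> off the multiples of \<open>m ^ t\<close>.\<close>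

section \<open>The substitution letter by letter\<close>

lemma length_toeplitz_subst:
  "length (toeplitz_subst W u) = Suc (length W) * length u"
  by (induction u) (auto simp: toeplitz_subst_def)

lemma nth_toeplitz_subst:
  assumes "i < Suc (length W) * length u"
  shows "toeplitz_subst W u ! i =
    (W @ [u ! (i div Suc (length W))]) ! (i mod Suc (length W))"
  using assms
proof (induction u arbitrary: i)
  case (Cons a u)
  let ?n = "Suc (length W)"
  have step: "toeplitz_subst W (a # u) = (W @ [a]) @ toeplitz_subst W u"
    by (simp add: toeplitz_subst_def)
  show ?case
  proof (cases "i < ?n")
    case True
    then show ?thesis by (simp only: step nth_append) (simp add: nth_append)
  next
    case False
    then have "i - ?n < ?n * length u" using Cons.prems by auto
    moreover have "i div ?n = Suc ((i - ?n) div ?n)" "i mod ?n = (i - ?n) mod ?n"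
      using False by (simp_all add: le_div_geq le_mod_geq)
    ultimately show ?thesis
      using Cons.IH[of "i - ?n"] False by (simp add: step nth_append)
  qed
qed simp

text \<open>Blocks have length \<open>m\<close>, so counting from 1 their last letters sit exactly
  at the multiples of \<open>m\<close>; the block ending at \<open>j\<close> comes from letter
  \<open>j div m\<close> of \<open>u\<close>.\<close>

lemma letter_toeplitz_subst:
  assumes "Suc (length W) = m" "1 \<le> j" "j \<le> m * length u"
  shows "letter (toeplitz_subst W u) j =
    (if m dvd j then letter u (j div m) else letter W (j mod m))"
proof -
  obtain i where i: "j = Suc i" using assms(2) by (cases j) auto
  have nth: "letter (toeplitz_subst W u) j = (W @ [u ! (i div m)]) ! (i mod m)"
    using nth_toeplitz_subst[of i W u] assms i by (simp add: letter_def)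
  have m: "m > 0" using assms(1) by auto
  show ?thesis
  proof (cases "m dvd j")
    case True
    then have s: "Suc (i mod m) = m" by (metis i mod_Suc dvd_eq_mod_eq_0 nat.distinct(1))
    then have l: "i mod m = length W" using assms(1) by simp
    have "i div m = j div m - 1" using True s i m by (metis diff_Suc_1 div_Suc dvd_eq_mod_eq_0)
    then show ?thesis using True nth l by (simp add: letter_def)
  next
    case False
    then have s: "j mod m = Suc (i mod m)" by (metis i mod_Suc dvd_eq_mod_eq_0)
    moreover have "j mod m < m" using m by simp
    ultimately have "i mod m < length W" using assms(1) by simp
    then show ?thesis using False nth s by (simp add: letter_def nth_append)
  qed
qed

lemma length_toeplitz_iterate:
  assumes "Suc (length W) = m"
  shows "length ((toeplitz_subst W ^^ k) u) = m ^ k * length u"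
  using assms by (induction k) (auto simp: length_toeplitz_subst)

lemma set_toeplitz_iterate:
  "set ((toeplitz_subst W ^^ k) u) \<subseteq> set W \<union> set u"
proof (induction k)
  case (Suc k)
  then show ?case by (auto simp: toeplitz_subst_def)
qed simp

section \<open>Fixed points as solutions of a recursion\<close>

text \<open>The conditions may range over all naturals: at \<open>j = 0\<close> the first is trivial
  and the second vacuous, so neither constrains the meaningless value \<open>X 0\<close>.\<close>

locale toeplitz_recursion =
  fixes m :: nat and X :: "nat \<Rightarrow> 'a"
  assumes two_le: "2 \<le> m"
    and mult: "X (m * j) = X j"
    and shift: "\<not> m dvd j \<Longrightarrow> X (j + m) = X j"

lemma toeplitz_fixed_point_imp_recursion:
  assumes "toeplitz_fixed_point A m X"
  shows "toeplitz_recursion m X" and "\<forall>j\<ge>1. X j \<in> A"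
proof -
  obtain W where m: "m \<ge> 2" and W: "set W \<subseteq> A" "length W = m - 1"
    and lim: "word_limit (\<lambda>k. (toeplitz_subst W ^^ k) [letter W 1]) X"
    using assms unfolding toeplitz_fixed_point_def by auto
  define w where "w k = (toeplitz_subst W ^^ k) [letter W 1]" for k
  have len: "Suc (length W) = m" using m W by auto
  have lenw: "length (w k) = m ^ k" for k
    unfolding w_def using length_toeplitz_iterate[OF len] by simp
  have wSuc: "w (Suc k) = toeplitz_subst W (w k)" for k
    by (simp add: w_def)
  have ev: "\<forall>\<^sub>F k in sequentially. j \<le> length (w k) \<and> letter (w k) j = X j"
    if "j \<ge> 1" for j
    using lim that unfolding word_limit_def w_def by auto
  \<comment> \<open>The substitution relates an iterate to the next one, so a single
    \<open>k\<close> is needed for which \<open>w k\<close> is already correct at \<open>j\<close>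
    and \<open>w (Suc k)\<close> at \<open>i\<close>.\<close>
  have ev': "\<exists>k. j \<le> length (w k) \<and> letter (w k) j = X j
        \<and> i \<le> length (w (Suc k)) \<and> letter (w (Suc k)) i = X i" if "j \<ge> 1" "i \<ge> 1" for i j
  proof -
    have "\<forall>\<^sub>F k in sequentially. i \<le> length (w (Suc k)) \<and> letter (w (Suc k)) i = X i"
      using ev[OF that(2)] eventually_sequentially_Suc[of "\<lambda>k. i \<le> length (w k) \<and> letter (w k) i = X i"]
      by simp
    then have "\<forall>\<^sub>F k in sequentially. (j \<le> length (w k) \<and> letter (w k) j = X j)
        \<and> i \<le> length (w (Suc k)) \<and> letter (w (Suc k)) i = X i"
      by (rule eventually_conj[OF ev[OF that(1)]])
    then show ?thesis by (auto dest!: eventually_happens)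
  qed
  have rec: "X i = letter W (i mod m)" if "\<not> m dvd i" for i
  proof -
    have "i \<ge> 1" using that by (cases i) auto
    then obtain k where "i \<le> length (w (Suc k))" "letter (w (Suc k)) i = X i"
      using ev'[of 1 i] by auto
    then show ?thesis
      using letter_toeplitz_subst[OF len \<open>i \<ge> 1\<close>, of "w k"] that
      by (simp add: wSuc length_toeplitz_subst len[symmetric])
  qed
  show "toeplitz_recursion m X"
  proof
    fix j
    show "X (m * j) = X j"
    proof (cases "j = 0")
      case False
      then have "m * j \<ge> 1" using m by auto
      then obtain k where k: "j \<le> length (w k)" "letter (w k) j = X j"
        "letter (w (Suc k)) (m * j) = X (m * j)"
        using ev'[of j "m * j"] False by auto
      then show ?thesis
        using letter_toeplitz_subst[OF len \<open>m * j \<ge> 1\<close>, of "w k"] m by (simp add: wSuc)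
    qed simp
  next
    fix j assume "\<not> m dvd j"
    then show "X (j + m) = X j" using rec[of j] rec[of "j + m"] by simp
  qed (fact m)
  show "\<forall>j\<ge>1. X j \<in> A"
  proof (intro allI impI)
    fix j :: nat assume "j \<ge> 1"
    then obtain k where k: "j \<le> length (w k)" "letter (w k) j = X j"
      using ev'[of j 1] by auto
    have "letter (w k) j \<in> set (w k)"
      using k(1) \<open>j \<ge> 1\<close> by (auto simp: letter_def)
    moreover have "letter W 1 \<in> set W" using W m by (auto simp: letter_def)
    then have "set (w k) \<subseteq> A"
      using set_toeplitz_iterate[of k W "[letter W 1]"] W(1) unfolding w_def by auto
    ultimately show "X j \<in> A" using k(2) by auto
  qed
qed

context toeplitz_recursion
begin

lemma shift_mult:
  assumes "\<not> m dvd j"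
  shows "X (j + m * t) = X j"
proof (induction t)
  case (Suc t)
  have "\<not> m dvd j + m * t" using assms by (simp add: dvd_add_left_iff)
  from shift[OF this] Suc show ?case by (simp add: algebra_simps)
qed simp

text \<open>The first \<open>m - 1\<close> letters of \<open>X\<close> serve as \<open>W\<close>. By
  induction on \<open>k\<close>, the \<open>k\<close>-th iterate agrees with \<open>X\<close> on its
  whole length \<open>m ^ k\<close>, since both obey the same recursion.\<close>

lemma toeplitz_fixed_point:
  assumes "\<forall>j\<ge>1. X j \<in> A"
  shows "toeplitz_fixed_point A m X"
proof -
  define W where "W = map X [1..<m]"
  have len: "Suc (length W) = m" using two_le by (auto simp: W_def)
  have WX: "letter W j = X j" if "1 \<le> j" "j < m" for j
    using that by (auto simp: W_def letter_def)
  have iter: "letter ((toeplitz_subst W ^^ k) [letter W 1]) j = X j" if "1 \<le> j" "j \<le> m ^ k" for j k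
    using that
  proof (induction k arbitrary: j)
    case 0
    then show ?case using WX[of 1] two_le by (simp add: letter_def)
  next
    case (Suc k)
    have eq: "letter ((toeplitz_subst W ^^ Suc k) [letter W 1]) j =
        (if m dvd j then letter ((toeplitz_subst W ^^ k) [letter W 1]) (j div m) else letter W (j mod m))"
      using letter_toeplitz_subst[OF len Suc.prems(1), of "(toeplitz_subst W ^^ k) [letter W 1]"]
        Suc.prems(2) length_toeplitz_iterate[OF len, of k] by simp
    show ?case
    proof (cases "m dvd j")
      case True
      then obtain i where i: "j = m * i" by auto
      then have "1 \<le> i" "i \<le> m ^ k" using Suc.prems two_le by auto
      then show ?thesis using Suc.IH[of i] eq i mult[of i] two_le by simp
    next
      case False
      then have nd: "\<not> m dvd j mod m" by (simp add: dvd_mod_iff)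
      then have "1 \<le> j mod m" by (cases "j mod m") auto
      then have "letter W (j mod m) = X (j mod m)" using WX two_le by simp
      also have "\<dots> = X j" using shift_mult[OF nd, of "j div m"] by simp
      finally show ?thesis using eq False by simp
    qed
  qed
  have "word_limit (\<lambda>k. (toeplitz_subst W ^^ k) [letter W 1]) X"
    unfolding word_limit_def
  proof (intro allI impI)
    fix j :: nat assume "1 \<le> j"
    show "\<forall>\<^sub>F k in sequentially. j \<le> length ((toeplitz_subst W ^^ k) [letter W 1]) \<and>
        letter ((toeplitz_subst W ^^ k) [letter W 1]) j = X j"
    proof (rule eventually_sequentiallyI[of j])
      fix k assume "j \<le> k"
      also have "k < 2 ^ k" by (rule less_exp)
      also have "(2::nat) ^ k \<le> m ^ k" using two_le by (rule power_mono) simp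
      finally have "j \<le> m ^ k" by simp
      then show "j \<le> length ((toeplitz_subst W ^^ k) [letter W 1]) \<and>
          letter ((toeplitz_subst W ^^ k) [letter W 1]) j = X j"
        using iter[OF \<open>1 \<le> j\<close>] length_toeplitz_iterate[OF len, of k] by simp
    qed
  qed
  moreover have "set W \<subseteq> A" using assms by (auto simp: W_def)
  ultimately show ?thesis
    using two_le len unfolding toeplitz_fixed_point_def by (intro conjI exI[of _ W]) auto
qed

section \<open>Powers of m as periods, and almost periodic prefixes\<close>

lemma shift_power:
  assumes "\<not> m ^ t dvd j"
  shows "X (j + m ^ t) = X j"
  using assms
proof (induction t arbitrary: j)
  case (Suc t)
  show ?case
  \<comment> \<open>A factor \<open>m\<close> of \<open>j\<close> is divided out by
    \<open>mult\<close>, which lowers \<open>t\<close>; without such a factor the shift is just a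
    multiple of \<open>m\<close>.\<close>
  proof (cases "m dvd j")
    case True
    then obtain i where i: "j = m * i" by auto
    then have "\<not> m ^ t dvd i" using Suc.prems by auto
    then have "X (i + m ^ t) = X i" by (rule Suc.IH)
    moreover have "j + m ^ Suc t = m * (i + m ^ t)" using i by (simp add: algebra_simps)
    ultimately show ?thesis using i mult by metis
  next
    case False
    then show ?thesis using shift_mult[of j "m ^ t"] by simp
  qed
qed simp

text \<open>Reducing \<open>j\<close> to its remainder \<open>r\<close> modulo \<open>m ^ t\<close>
  changes neither \<open>X j\<close> nor \<open>X (j + q)\<close>, so only pairs starting inside the
  prefix matter. The prefix condition covers them unless \<open>r + q\<close> overshoots the
  end.\<close>

lemma almost_periodic_prefix_iff:
  assumes "2 \<le> q" "q dvd m ^ t" "q \<noteq> m ^ t"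
  shows "almost_periodic q (prefix_word X (m ^ t)) \<longleftrightarrow> (\<forall>j. \<not> q dvd j \<longrightarrow> X (j + q) = X j)"
proof -
  define M where "M = m ^ t"
  have "M > 0" using two_le by (simp add: M_def)
  have qM: "q dvd M" "q < M" using assms \<open>M > 0\<close> dvd_imp_le[of q M] by (auto simp: M_def)
  have len: "length (prefix_word X M) = M" by (simp add: prefix_word_def)
  have let_pre: "letter (prefix_word X M) j = X j" if "1 \<le> j" "j \<le> M" for j
    using that by (auto simp: prefix_word_def letter_def simp del: upt_Suc)
  have ap: "almost_periodic q (prefix_word X M) \<longleftrightarrow>
      (\<forall>j. j + q \<le> M \<and> \<not> q dvd j \<longrightarrow> X (j + q) = X j)"
  proof -
    have "(1 \<le> j \<and> j \<le> M - q \<and> \<not> q dvd j \<longrightarrow>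
          letter (prefix_word X M) j = letter (prefix_word X M) (j + q)) \<longleftrightarrow>
        (j + q \<le> M \<and> \<not> q dvd j \<longrightarrow> X (j + q) = X j)" for j
    proof (cases "j = 0")
      case False
      then show ?thesis using qM(2) let_pre[of j] let_pre[of "j + q"] by auto
    qed simp
    then show ?thesis unfolding almost_periodic_def len using assms(1) qM(2) by simp
  qed
  have "X (j + q) = X j"
    if per: "\<forall>j. j + q \<le> M \<and> \<not> q dvd j \<longrightarrow> X (j + q) = X j" and j: "\<not> q dvd j" for j
  proof -
    have shiftM: "X (i + M * s) = X i" if "\<not> q dvd i" for i s
    proof (induction s)
      case (Suc s)
      have "\<not> q dvd i + M * s" using that qM(1) by (simp add: dvd_add_left_iff)
      then have "\<not> M dvd i + M * s" using qM(1) dvd_trans by blast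
      then have "X (i + M * s + M) = X (i + M * s)" using shift_power[of t] by (simp add: M_def)
      then show ?case using Suc by (simp add: algebra_simps)
    qed simp
    define r where "r = j mod M"
    have r: "\<not> q dvd r" "r < M" using j qM \<open>M > 0\<close> by (simp_all add: r_def dvd_mod_iff)
    have jr: "j = r + M * (j div M)" by (simp add: r_def)
    have Xj: "X j = X r" using shiftM[OF r(1)] jr by metis
    have "\<not> q dvd r + q" using r(1) by simp
    then have "X (r + q + M * (j div M)) = X (r + q)" by (rule shiftM)
    moreover have "r + q + M * (j div M) = j + q" using jr by linarith
    ultimately have Xjq: "X (j + q) = X (r + q)" by simp
    have "X (r + q) = X r"
    proof (cases "r + q \<le> M")
      case False
      \<comment> \<open>The overshooting position wraps around to \<open>r0\<close>. As
        \<open>q\<close> divides \<open>M\<close>, \<open>r0\<close> is congruent to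
        \<open>r\<close> modulo \<open>q\<close>, and steps of length \<open>q\<close> inside the
        prefix lead from \<open>r0\<close> up to \<open>r\<close>.\<close>
      define r0 where "r0 = r + q - M"
      have r0: "r + q = r0 + M" using False by (simp add: r0_def)
      then have nd: "\<not> q dvd r0" using r(1) qM(1)
        by (metis dvd_add_left_iff dvd_add_triv_right_iff)
      have chain: "X (r0 + q * s) = X r0" if "r0 + q * s \<le> M" for s
        using that
      proof (induction s)
        case (Suc s)
        have "\<not> q dvd r0 + q * s" using nd by (simp add: dvd_add_left_iff)
        moreover have "r0 + q * s + q \<le> M" using Suc.prems by (simp add: algebra_simps)
        ultimately have "X (r0 + q * s + q) = X (r0 + q * s)" using per by blast
        then show ?case using Suc by (simp add: algebra_simps)
      qed simp
      obtain c where c: "M = q * c" using qM(1) by auto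
      then obtain s where "c = Suc s" using qM(2) by (cases c) auto
      then have "r = r0 + q * s" using r0 c by (simp add: algebra_simps)
      then have "X r = X r0" using chain[of s] r(2) by simp
      moreover have "X (r + q) = X r0" using shiftM[OF nd, of 1] r0 by simp
      ultimately show ?thesis by simp
    qed (use per r(1) in blast)
    then show ?thesis using Xj Xjq by simp
  qed
  then show ?thesis using ap unfolding M_def by blast
qed

section \<open>Words along the multiples of q\<close>

text \<open>A shift by \<open>m\<close> in the new word is a shift by \<open>m * q\<close> in
  \<open>X\<close>. If \<open>m\<close> divides \<open>q * j\<close>, cancelling \<open>m\<close>
  turns it into a shift by \<open>q\<close>; otherwise it is a multiple of the shift by
  \<open>m\<close>.\<close>

lemma recursion_multiples:
  assumes "q > 0" and per: "\<forall>j. \<not> q dvd j \<longrightarrow> X (j + q) = X j"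
  shows "toeplitz_recursion m (subword_multiples X q)"
proof
  fix j
  show "subword_multiples X q (m * j) = subword_multiples X q j"
    using mult[of "q * j"] by (simp add: subword_multiples_def ac_simps)
  assume j: "\<not> m dvd j"
  have "X (q * j + m * q) = X (q * j)"
  proof (cases "m dvd q * j")
    case True
    then obtain i where i: "q * j = m * i" by auto
    have "\<not> q dvd i"
    proof
      assume "q dvd i"
      then obtain a where "i = q * a" by auto
      then have "j = m * a" using i assms(1) by simp
      then show False using j by simp
    qed
    then have "X (i + q) = X i" using per by simp
    moreover have "q * j + m * q = m * (i + q)" using i by (simp add: algebra_simps)
    ultimately show ?thesis using i mult by metis
  next
    case False
    then show ?thesis by (rule shift_mult)
  qed
  then show "subword_multiples X q (j + m) = subword_multiples X q j"
    by (simp add: subword_multiples_def algebra_simps)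
qed (fact two_le)

lemma multiples_eq_const:
  assumes "toeplitz_recursion m (subword_multiples X q)"
    and q: "q = g * e * g * p" and m: "m = g * e * n" and "coprime g n"
    and "\<not> m dvd q" and "\<not> g dvd k"
  shows "X (p * k) = X q"
proof -
  interpret Y: toeplitz_recursion m "subword_multiples X q" by fact
  have pos: "e > 0" "n > 0" using m two_le by (auto intro: Nat.gr0I)
  \<comment> \<open>Chosen so that \<open>q * j = m * m * (p * k)\<close>. Then
    \<open>X (q * j)\<close> reduces to \<open>X (p * k)\<close>, while the shifted position is
    \<open>m * (q + m * (p * k))\<close>, where \<open>X\<close> takes the value \<open>X q\<close>
    because \<open>m\<close> does not divide \<open>q\<close>.\<close>
  define j where "j = e * n * (n * k)"
  have "\<not> m dvd j"
  proof
    assume "m dvd j"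
    then have "(e * n) * g dvd (e * n) * (n * k)" by (simp add: j_def m ac_simps)
    then have "g dvd n * k" using pos by simp
    then show False using assms(4,6) by (simp add: coprime_dvd_mult_right_iff)
  qed
  then have "X (q * j + q * m) = X (q * j)"
    using Y.shift[of j] by (simp add: subword_multiples_def algebra_simps)
  moreover have "q * j = m * (m * (p * k))" by (simp add: q m j_def ac_simps)
  moreover have "q * j + q * m = m * (q + m * (p * k))" using calculation(2) by (simp add: algebra_simps)
  ultimately show ?thesis using mult shift_mult[OF assms(5)] by metis
qed

lemma constant_of_multiples_eq_const:
  assumes const: "\<And>k. \<not> g dvd k \<Longrightarrow> X (p * k) = c"
    and m: "m = g * h" and "coprime p h" and "p \<noteq> 1" and "p dvd m ^ s"
  shows "constant_word X"
proof -
  have "g > 0" using m two_le by (auto intro: Nat.gr0I)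
  have nondvd: "X j = c" if nd: "\<not> p dvd j" for j
  proof -
    \<comment> \<open>Multiplying \<open>j\<close> by \<open>m\<close> preserves the letter, so it
      suffices to reach a multiple \<open>p * k\<close> with \<open>g\<close> not dividing
      \<open>k\<close>. The first power of \<open>m\<close> that brings in \<open>p\<close> works:
      if \<open>g\<close> divided \<open>k\<close>, coprimality of \<open>p\<close> and
      \<open>h\<close> would make the preceding power work already.\<close>
    define i where "i = (LEAST i. p dvd m ^ i * j)"
    have "p dvd m ^ s * j" using assms(5) by simp
    then have i: "p dvd m ^ i * j" unfolding i_def by (rule LeastI)
    then obtain l where l: "i = Suc l" using nd i by (cases i) auto
    then have min: "\<not> p dvd m ^ l * j" using not_less_Least[of l "\<lambda>i. p dvd m ^ i * j"] i_def by auto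
    obtain k where k: "m ^ i * j = p * k" using i by auto
    have "\<not> g dvd k"
    proof
      assume "g dvd k"
      then obtain a where a: "k = g * a" by auto
      have "g * (h * (m ^ l * j)) = g * (p * a)" using k a l by (simp add: m ac_simps)
      then have "h * (m ^ l * j) = p * a" using \<open>g > 0\<close> by simp
      then have "p dvd h * (m ^ l * j)" by simp
      then show False using min assms(3) by (simp add: coprime_dvd_mult_right_iff)
    qed
    then have "X (p * k) = c" by (rule const)
    moreover have "X (m ^ i * j) = X j"
    proof (induction i)
      case (Suc i)
      then show ?case using mult[of "m ^ i * j"] by (simp add: mult.assoc)
    qed simp
    ultimately show ?thesis using k by simp
  qed
  have "X j = c" if "j \<ge> 1" for j
    using that
  proof (induction j rule: less_induct)
    case (less j)
    show ?case
    proof (cases "m dvd j")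
      case True
      then obtain i where i: "j = m * i" by auto
      then have "1 \<le> i" "i < j" using less.prems two_le by auto
      then show ?thesis using less.IH[of i] i mult by simp
    next
      case False
      then have Xj: "X (j + m) = X j" by (rule shift)
      show ?thesis
      \<comment> \<open>Since \<open>j\<close> and \<open>j + m\<close> carry the same letter, it is
        enough that one of them is known to carry \<open>c\<close>. If \<open>p\<close> divides
        both, the hypothesis \<open>const\<close> decides; otherwise one of them is not a multiple
        of \<open>p\<close>.\<close>
      proof (cases "p dvd j \<and> p dvd m")
        case True
        then obtain k where k: "j = p * k" by auto
        have "p dvd g" using True assms(3) by (simp add: m coprime_dvd_mult_left_iff)
        then obtain f where f: "g = p * f" by auto
        have "f > 0" using f \<open>g > 0\<close> by auto
        have "\<not> g dvd f * h"
        proof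
          assume "g dvd f * h"
          then have "f * p dvd f * h" using f by (simp add: ac_simps)
          then have "p dvd h" using \<open>f > 0\<close> by simp
          then show False using assms(3,4) by (simp add: coprime_absorb_left)
        qed
        then have "\<not> g dvd k \<or> \<not> g dvd k + f * h" by (auto simp: dvd_add_right_iff)
        moreover have "j + m = p * (k + f * h)" using k f by (simp add: m algebra_simps)
        ultimately show ?thesis using const k Xj by metis
      next
        case False
        then have "\<not> p dvd j \<or> \<not> p dvd j + m" by (auto simp: dvd_add_right_iff)
        then show ?thesis using nondvd Xj by metis
      qed
    qed
  qed
  then show ?thesis unfolding constant_word_def by blast
qed

text \<open>If \<open>g\<close> does not divide \<open>j\<close>, it does not divide
  \<open>j + q\<close> either, and both letters equal \<open>X q\<close> by
  \<open>multiples_eq_const\<close> with \<open>p = 1\<close>. If \<open>j = g * i\<close>, the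
  shift of the new word at \<open>n * i\<close> is, after cancelling \<open>m\<close>, the shift of
  \<open>X\<close> from \<open>j\<close> to \<open>j + q\<close>.\<close>

lemma shift_of_recursion_multiples:
  assumes "toeplitz_recursion m (subword_multiples X q)"
    and q: "q = g * e * g" and m: "m = g * e * n" and "coprime g n"
    and "\<not> m dvd q" and "\<not> q dvd j"
  shows "X (j + q) = X j"
proof (cases "g dvd j")
  case False
  moreover have "\<not> g dvd j + q" using False by (simp add: q dvd_add_left_iff)
  ultimately show ?thesis
    using multiples_eq_const[of q g e 1 n] assms by simp
next
  case True
  interpret Y: toeplitz_recursion m "subword_multiples X q" by fact
  obtain i where i: "j = g * i" using True by auto
  have pos: "n > 0" using m two_le by (auto intro: Nat.gr0I)
  have "\<not> m dvd n * i"
  proof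
    assume "m dvd n * i"
    then have "n * (g * e) dvd n * i" by (simp add: m ac_simps)
    then have "g * e dvd i" using pos by simp
    then have "q dvd j" using mult_dvd_mono[of g g "g * e" i] by (simp add: q i ac_simps)
    then show False using assms(6) by simp
  qed
  then have "X (q * (n * i) + q * m) = X (q * (n * i))"
    using Y.shift[of "n * i"] by (simp add: subword_multiples_def algebra_simps)
  moreover have "q * (n * i) = m * j" by (simp add: q m i ac_simps)
  moreover have "q * (n * i) + q * m = m * (j + q)" using calculation(2) by (simp add: algebra_simps)
  ultimately show ?thesis using mult by metis
qed

end

section \<open>Arithmetic of q and m, and the conclusion\<close>

text \<open>Two gcds are split off: first \<open>d = gcd q m\<close> from \<open>q\<close> and
  \<open>m\<close>, leaving \<open>q1\<close> and \<open>n\<close>, then \<open>g = gcd q1 d\<close>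
  from \<open>q1\<close> and \<open>d\<close>, leaving \<open>p\<close> and
  \<open>e\<close>.\<close>

lemma gcd_factorization:
  fixes q m :: nat
  assumes "q > 0" "m > 0"
  obtains g e n p where "q = g * e * g * p" "m = g * e * n" "coprime (g * p) n" "coprime p e"
proof -
  obtain q1 n where 1: "q = q1 * gcd q m" "m = n * gcd q m" "coprime q1 n"
    using gcd_coprime_exists[of q m] assms by auto
  obtain p e where 2: "q1 = p * gcd q1 (gcd q m)" "gcd q m = e * gcd q1 (gcd q m)" "coprime p e"
    using gcd_coprime_exists[of q1 "gcd q m"] assms by auto
  define d where "d = gcd q m"
  define g where "g = gcd q1 d"
  have "q = q1 * d" "m = n * d" "q1 = p * g" "d = e * g"
    using 1 2 by (simp_all add: d_def g_def)
  then show ?thesis using that[of g e p n] 1(3) 2(3) by (simp add: ac_simps)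
qed

theorem theorem1p1:
  fixes A :: "'a set" and m q :: nat and X :: "nat \<Rightarrow> 'a"
  assumes "finite A"
    and "m \<ge> 2"
    and "toeplitz_fixed_point A m X"
    and "\<not> constant_word X"
    and "q \<ge> 2"
    and "\<not> m dvd q"
    and "\<exists>s\<ge>1. q dvd m ^ s"
  shows "(\<not> q dvd m\<^sup>2 \<longrightarrow> \<not> toeplitz_fixed_point A m (subword_multiples X q)) \<and>
         (q dvd m \<longrightarrow>
            (toeplitz_fixed_point A m (subword_multiples X q) \<longleftrightarrow>
             almost_periodic q (prefix_word X m))) \<and>
         (q dvd m\<^sup>2 \<longrightarrow>
            (toeplitz_fixed_point A m (subword_multiples X q) \<longleftrightarrow>
             almost_periodic q (prefix_word X (m\<^sup>2))))"
proof -
  interpret toeplitz_recursion m X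
    using toeplitz_fixed_point_imp_recursion(1)[OF assms(3)] .
  have XA: "\<forall>j\<ge>1. X j \<in> A"
    using toeplitz_fixed_point_imp_recursion(2)[OF assms(3)] .
  obtain s where s: "q dvd m ^ s" using assms(7) by auto
  have "q > 0" "m > 0" using assms by auto
  then obtain g e n p where q: "q = g * e * g * p" and m: "m = g * e * n"
    and cop: "coprime (g * p) n" and pe: "coprime p e"
    by (rule gcd_factorization)
  have gn: "coprime g n" and pn: "coprime p n" using cop by simp_all
  let ?Y = "subword_multiples X q"
  have YA: "\<forall>j\<ge>1. ?Y j \<in> A" using XA \<open>q > 0\<close> by (simp add: subword_multiples_def)
  have Y: "toeplitz_fixed_point A m ?Y \<longleftrightarrow> toeplitz_recursion m ?Y"
    using toeplitz_fixed_point_imp_recursion(1) toeplitz_recursion.toeplitz_fixed_point YA by blast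
  have i: "\<not> toeplitz_recursion m ?Y" if "\<not> q dvd m\<^sup>2"
  proof
    assume rec: "toeplitz_recursion m ?Y"
    have "p \<noteq> 1"
    proof
      assume "p = 1"
      then have "m\<^sup>2 = q * (e * n * n)" by (simp add: q m power2_eq_square ac_simps)
      then show False using that by simp
    qed
    moreover have "coprime p (e * n)" using pe pn by simp
    moreover have "p dvd m ^ s" using s q by (metis dvd_triv_right dvd_trans)
    moreover have "X (p * k) = X q" if "\<not> g dvd k" for k
      using multiples_eq_const[OF rec q m gn assms(6) that] .
    ultimately have "constant_word X"
      using constant_of_multiples_eq_const[of g p "X q" "e * n" s] m by (simp add: mult.assoc)
    then show False using assms(4) by simp
  qed
  have iii: "toeplitz_recursion m ?Y \<longleftrightarrow> (\<forall>j. \<not> q dvd j \<longrightarrow> X (j + q) = X j)" if "q dvd m\<^sup>2"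
  proof
    assume rec: "toeplitz_recursion m ?Y"
    \<comment> \<open>This is \<open>q dvd m * m\<close> in factored form; after cancellation
      \<open>p\<close> divides a number coprime to it, hence \<open>p = 1\<close>.\<close>
    have "(g * e * g) * p dvd (g * e * g) * (e * n * n)"
      using that by (simp add: q m power2_eq_square ac_simps)
    moreover have "g * e * g > 0" using \<open>q > 0\<close> q by (intro Nat.gr0I) auto
    ultimately have "p dvd e * n * n" by (metis nat_mult_dvd_cancel1)
    moreover have "coprime p (e * n * n)" using pe pn by simp
    ultimately have "is_unit p" using coprime_absorb_left by blast
    then have "p = 1" by simp
    then show "\<forall>j. \<not> q dvd j \<longrightarrow> X (j + q) = X j"
      using shift_of_recursion_multiples[OF rec _ m gn assms(6)] q by simp
  qed (use recursion_multiples[OF \<open>q > 0\<close>] in blast)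
  have "q \<noteq> m" "q \<noteq> m\<^sup>2" using assms(6) by auto
  show ?thesis
  proof (intro conjI impI)
    assume "\<not> q dvd m\<^sup>2"
    then show "\<not> toeplitz_fixed_point A m ?Y" using i Y by simp
  next
    assume "q dvd m"
    \<comment> \<open>The same shift criterion thus applies, now read off the prefix with exponent
      1.\<close>
    then have "q dvd m\<^sup>2" by (simp add: power2_eq_square)
    then show "toeplitz_fixed_point A m ?Y \<longleftrightarrow> almost_periodic q (prefix_word X m)"
      using almost_periodic_prefix_iff[of q 1] iii Y \<open>q dvd m\<close> \<open>q \<noteq> m\<close> assms(5) by simp
  next
    assume "q dvd m\<^sup>2"
    then show "toeplitz_fixed_point A m ?Y \<longleftrightarrow> almost_periodic q (prefix_word X (m\<^sup>2))"
      using almost_periodic_prefix_iff[of q 2] iii Y \<open>q \<noteq> m\<^sup>2\<close> assms(5) by simp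
  qed
qed

end
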